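(* Let $X$ be a log-concave real random variable (not necessarily symmetric) and let $\alpha\geq 2$. Then \[ h_\alpha(X)\ \geq\ \tfrac12\log \mathrm{Var}(X)+\frac{\log\alpha}{\alpha-1}, \] with equality when $X$ is a one-sided exponential random variable.
   Context: A real random variable $X$ is log-concave if it has a density (with respect to Lebesgue measure) of the form $f=e^{-V}$ with $V:\mathbb{R}\to(-\infty,\infty]$ convex. For a random variable $X$ with density $f$ and $\alpha\in(0,\infty)\setminus\{1\}$, the Rényi entropy of order $\alpha$ is $h_\alpha(X)=\frac{1}{1-\alpha}\log\left(\int f^\alpha(x)\,\mathrm{d}x\right)$. A one-sided exponential random variable is one with density $\lambda e^{-\lambda x}\mathbf{1}_{[0,\infty)}(x)$ for some $\lambda>0$. $\log$ is the natural logarithm. *)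

theory Defs
  imports "HOL-Probability.Probability"
begin

definition exp_uminus :: "ereal \<Rightarrow> real" where
  "exp_uminus v = (if v = \<infinity> then 0 else exp (- real_of_ereal v))"

(* convex_on only covers real-valued functions. In ereal, 0 * \<infinity> = 0, so the
   cases u = 0 and v = 0 of the inequality are trivially true, as they should be. *)
definition ereal_convex :: "(real \<Rightarrow> ereal) \<Rightarrow> bool" where
  "ereal_convex V \<longleftrightarrow> (\<forall>x. V x \<noteq> -\<infinity>) \<and>
     (\<forall>x y u v. 0 \<le> u \<longrightarrow> 0 \<le> v \<longrightarrow> u + v = 1 \<longrightarrow>
        V (u * x + v * y) \<le> ereal u * V x + ereal v * V y)"

definition log_concave_rv :: "'a measure \<Rightarrow> ('a \<Rightarrow> real) \<Rightarrow> bool" where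
  "log_concave_rv M X \<longleftrightarrow>
     (\<exists>V. ereal_convex V \<and> distributed M lborel X (\<lambda>x. ennreal (exp_uminus (V x))))"

(* The density is taken to be the Radon-Nikodym derivative of the law of X, as for the entropy
   in HOL-Probability.Information; renyi_entropy_distributed below shows that every other version
   of the density gives the same value. The value is meaningful only if the integral is finite,
   which holds for log-concave X and \<alpha> > 0. *)
definition renyi_entropy :: "'a measure \<Rightarrow> real \<Rightarrow> ('a \<Rightarrow> real) \<Rightarrow> real" where
  "renyi_entropy M \<alpha> X =
     1 / (1 - \<alpha>) * ln (\<integral>x. enn2real (RN_deriv lborel (distr M lborel X) x) powr \<alpha> \<partial>lborel)"

lemma renyi_entropy_distributed:
  fixes f :: "real \<Rightarrow> real"
  assumes D: "distributed M lborel X (\<lambda>x. ennreal (f x))" and nn: "\<And>x. 0 \<le> f x"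
  shows "renyi_entropy M \<alpha> X = 1 / (1 - \<alpha>) * ln (\<integral>x. f x powr \<alpha> \<partial>lborel)"
proof -
  have m: "(\<lambda>x. ennreal (f x)) \<in> borel_measurable lborel"
    using D by (rule distributed_borel_measurable)
  have fm: "f \<in> borel_measurable lborel"
    using borel_measurable_enn2real[OF m] nn by simp
  have ae: "AE x in lborel. ennreal (f x) = RN_deriv lborel (distr M lborel X) x"
    by (rule sigma_finite_measure.RN_deriv_unique[OF sigma_finite_lborel m]) (simp add: distributed_distr_eq_density[OF D])
  have "(\<integral>x. f x powr \<alpha> \<partial>lborel)
      = (\<integral>x. enn2real (RN_deriv lborel (distr M lborel X) x) powr \<alpha> \<partial>lborel)"
  proof (rule integral_cong_AE)
    show "AE x in lborel. f x powr \<alpha> = enn2real (RN_deriv lborel (distr M lborel X) x) powr \<alpha>"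
      using ae by eventually_elim (metis enn2real_ennreal nn)
  qed (use fm in measurable)
  then show ?thesis
    by (simp add: renyi_entropy_def)
qed

lemma exponential_log_concave_rv:
  assumes l: "0 < l" and D: "distributed M lborel X (exponential_density l)"
  shows "log_concave_rv M X"
proof -
  define V where "V x = (if x < 0 then \<infinity> else ereal (x * l - ln l))" for x
  have "exponential_density l x = exp_uminus (V x)" for x
    using l by (simp add: V_def exp_uminus_def exponential_density_def exp_diff
        exp_minus field_simps)
  moreover have "ereal_convex V"
    unfolding ereal_convex_def
  proof (intro conjI allI impI)
    fix x y u v :: real
    assume uv: "0 \<le> u" "0 \<le> v" "u + v = 1"
    show "V (u * x + v * y) \<le> ereal u * V x + ereal v * V y"
    proof (cases "u = 0 \<or> v = 0")
      case True
      with uv show ?thesis by (auto simp flip: zero_ereal_def)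
    next
      case False
      with uv have pos: "0 < u" "0 < v" by auto
      show ?thesis
      proof (cases "x < 0 \<or> y < 0")
        case True
        then show ?thesis
          using pos by (auto simp: V_def)
      next
        case False
        then have "0 \<le> u * x + v * y"
          using uv by simp
        moreover have "(u * x + v * y) * l - ln l = u * (x * l - ln l) + v * (y * l - ln l)"
        proof -
          have "v = 1 - u" using uv by simp
          then show ?thesis unfolding \<open>v = 1 - u\<close> by algebra
        qed
        ultimately show ?thesis
          using False by (simp add: V_def)
      qed
    qed
  qed (simp add: V_def)
  ultimately show ?thesis
    using D unfolding log_concave_rv_def by auto
qed

end

theory Submission
  imports Defs
begin

text \<open>
  Let \<open>f\<close> be the density and \<open>g z = \<integral> f x * f (x + z)\<close> the density of the difference of two
  independent copies of \<open>X\<close>. By the Prekopa--Leindler inequality \<open>g\<close> is log-concave; it is even with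
  \<open>g 0 = \<integral> f\<^sup>2\<close>, so comparison with the Laplace density of the same value at \<open>0\<close> gives
  \<open>2 * Var X \<le> 1 / (2 * (\<integral> f\<^sup>2)\<^sup>2)\<close>, which is the case \<open>\<alpha> = 2\<close>. For \<open>\<alpha> > 2\<close>, the Prekopa--Leindler
  inequality for \<open>f x\<close>, \<open>f (x / \<alpha>) powr \<alpha>\<close> and \<open>f (x / 2) powr 2\<close> (log-concavity of
  \<open>p \<mapsto> p * \<integral> f powr p\<close>) gives \<open>\<alpha> * \<integral> f powr \<alpha> \<le> (2 * \<integral> f\<^sup>2) powr (\<alpha> - 1)\<close>.
\<close>

subsection \<open>The one-dimensional Prekopa--Leindler inequality\<close>

lemma emeasure_lborel_vimage_affine:
  fixes c t :: real
  assumes [measurable]: "A \<in> sets borel" and c: "c \<noteq> 0"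
  shows "emeasure lborel A = ennreal \<bar>c\<bar> * emeasure lborel ((\<lambda>x. t + c * x) -` A)"
proof -
  have m: "(\<lambda>x. t + c * x) -` A \<in> sets borel"
    using measurable_sets_borel[of "\<lambda>x. t + c * x" borel A] by simp
  have "emeasure lborel A = (\<integral>\<^sup>+x. indicator A x \<partial>lborel)"
    by simp
  also have "\<dots> = ennreal \<bar>c\<bar> * (\<integral>\<^sup>+x. indicator A (t + c * x) \<partial>lborel)"
    by (rule nn_integral_real_affine) (use c in auto)
  also have "(\<integral>\<^sup>+x. indicator A (t + c * x) \<partial>lborel)
      = (\<integral>\<^sup>+x. indicator ((\<lambda>x. t + c * x) -` A) x \<partial>lborel)"
    by (intro nn_integral_cong) (auto simp: indicator_def)
  finally show ?thesis
    using m by simp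
qed

lemma emeasure_lborel_sumset_bounded:
  fixes A B C :: "real set"
  assumes [measurable]: "A \<in> sets borel" "B \<in> sets borel" "C \<in> sets borel"
    and ne: "A \<noteq> {}" "B \<noteq> {}" and bd: "bdd_above A" "bdd_below B"
    and C: "\<And>a b. a \<in> A \<Longrightarrow> b \<in> B \<Longrightarrow> a + b \<in> C"
  shows "emeasure lborel A + emeasure lborel B \<le> emeasure lborel C"
proof (rule ennreal_le_epsilon)
  fix e :: real assume e: "0 < e"
  \<comment> \<open>\<open>Sup A\<close> and \<open>Inf B\<close> need not be attained, so each is
    approximated to within \<open>e / 2\<close>. The overlap of the translates then lies in an
    interval of length at most \<open>e\<close>.\<close>
  obtain a where a: "a \<in> A" "Sup A - e / 2 < a"
    using less_cSup_iff[OF ne(1) bd(1), of "Sup A - e / 2"] e by auto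
  obtain b where b: "b \<in> B" "b < Inf B + e / 2"
    using cInf_less_iff[OF ne(2) bd(2), of "Inf B + e / 2"] e by auto
  \<comment> \<open>The translates \<open>A + b\<close> and \<open>a + B\<close> lie in \<open>C\<close> and overlap in a set of length at most \<open>e\<close>.\<close>
  define A' where "A' = (\<lambda>x. - b + 1 * x) -` A"
  define B' where "B' = (\<lambda>x. - a + 1 * x) -` B"
  have [measurable]: "A' \<in> sets borel" "B' \<in> sets borel"
    using measurable_sets_borel[of "\<lambda>x. - b + 1 * x" borel A]
      measurable_sets_borel[of "\<lambda>x. - a + 1 * x" borel B] by (simp_all add: A'_def B'_def)
  have sub: "A' \<union> B' \<subseteq> C"
  proof
    fix x assume "x \<in> A' \<union> B'"
    then show "x \<in> C"
      using C[of "x - b" b] C[of a "x - a"] a b by (auto simp: A'_def B'_def)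
  qed
  have int: "A' \<inter> B' \<subseteq> {a + Inf B .. Sup A + b}"
  proof
    fix x assume "x \<in> A' \<inter> B'"
    then have "x - b \<le> Sup A" "Inf B \<le> x - a"
      using cSup_upper[OF _ bd(1), of "x - b"] cInf_lower[OF _ bd(2), of "x - a"]
      by (auto simp: A'_def B'_def)
    then show "x \<in> {a + Inf B .. Sup A + b}"
      by auto
  qed
  have "emeasure lborel (A' \<inter> B') \<le> emeasure lborel {a + Inf B .. Sup A + b}"
    by (intro emeasure_mono int) auto
  also have "\<dots> \<le> ennreal e"
    using a b e by (auto simp: emeasure_lborel_Icc_eq intro!: ennreal_leI)
  finally have ov: "emeasure lborel (A' \<inter> B') \<le> ennreal e" .
  have "emeasure lborel A + emeasure lborel B = emeasure lborel A' + emeasure lborel B'"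
    using emeasure_lborel_vimage_affine[of A 1 "- b"] emeasure_lborel_vimage_affine[of B 1 "- a"]
    by (simp add: A'_def B'_def)
  also have "\<dots> = emeasure lborel (A' \<union> B') + emeasure lborel (A' \<inter> B')"
    by (rule emeasure_Un_Int) auto
  also have "\<dots> \<le> emeasure lborel C + ennreal e"
    by (intro add_mono ov emeasure_mono sub) auto
  finally show "emeasure lborel A + emeasure lborel B \<le> emeasure lborel C + ennreal e" .
qed

text \<open>Truncating \<open>A\<close> from above and \<open>B\<close> from below gives exactly the
  boundedness required by \<open>emeasure_lborel_sumset_bounded\<close>; the measures of the
  truncations increase to those of \<open>A\<close> and \<open>B\<close>. \<open>C\<close> is any
  Borel set containing the sumset, because a sumset of Borel sets need not be Borel.\<close>

lemma brunn_minkowski_real: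
  fixes A B C :: "real set"
  assumes [measurable]: "A \<in> sets borel" "B \<in> sets borel" "C \<in> sets borel"
    and ne: "A \<noteq> {}" "B \<noteq> {}"
    and C: "\<And>a b. a \<in> A \<Longrightarrow> b \<in> B \<Longrightarrow> a + b \<in> C"
  shows "emeasure lborel A + emeasure lborel B \<le> emeasure lborel C"
proof -
  define S where "S n = A \<inter> {..real n}" for n
  define T where "T n = B \<inter> {- real n..}" for n
  have [measurable]: "S n \<in> sets borel" "T n \<in> sets borel" for n
    by (auto simp: S_def T_def)
  have US: "(\<Union>n. S n) = A"
    by (auto simp: S_def intro: real_arch_simple)
  have UT: "(\<Union>n. T n) = B"
  proof -
    have "\<exists>n. - real n \<le> x" for x :: real
      using real_arch_simple[of "- x"] by (auto simp: minus_le_iff)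
    then show ?thesis by (auto simp: T_def)
  qed
  have "(\<lambda>n. emeasure lborel (S n)) \<longlonglongrightarrow> emeasure lborel A"
    unfolding US[symmetric] by (rule Lim_emeasure_incseq) (auto simp: incseq_def S_def)
  moreover have "(\<lambda>n. emeasure lborel (T n)) \<longlonglongrightarrow> emeasure lborel B"
    unfolding UT[symmetric] by (rule Lim_emeasure_incseq) (auto simp: incseq_def T_def)
  ultimately have lim: "(\<lambda>n. emeasure lborel (S n) + emeasure lborel (T n))
      \<longlonglongrightarrow> emeasure lborel A + emeasure lborel B"
    by (rule tendsto_add)
  \<comment> \<open>The bounded case needs nonempty sets, so only the truncations that already
    contain \<open>a\<close> and \<open>b\<close> are used.\<close>
  obtain a b where ab: "a \<in> A" "b \<in> B"
    using ne by auto
  obtain N where N: "max a (- b) \<le> real N"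
    using real_arch_simple by blast
  show ?thesis
  proof (rule LIMSEQ_le_const2[OF lim], intro exI allI impI)
    fix n assume "N \<le> n"
    then have "a \<in> S n" "b \<in> T n"
      using N ab by (auto simp: S_def T_def)
    then show "emeasure lborel (S n) + emeasure lborel (T n) \<le> emeasure lborel C"
      by (intro emeasure_lborel_sumset_bounded) (auto simp: S_def T_def intro: C)
  qed
qed

text \<open>This is the sumset inequality for the dilates of \<open>A\<close> and \<open>B\<close>
  by \<open>u\<close> and \<open>v\<close>. They are written as preimages under division, which
  makes them visibly Borel.\<close>

lemma brunn_minkowski_real_convex:
  fixes A B C :: "real set"
  assumes [measurable]: "A \<in> sets borel" "B \<in> sets borel" "C \<in> sets borel"
    and ne: "A \<noteq> {}" "B \<noteq> {}" and uv: "0 < u" "0 < v"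
    and C: "\<And>a b. a \<in> A \<Longrightarrow> b \<in> B \<Longrightarrow> u * a + v * b \<in> C"
  shows "ennreal u * emeasure lborel A + ennreal v * emeasure lborel B \<le> emeasure lborel C"
proof -
  have scale: "emeasure lborel ((\<lambda>x. 0 + (1 / w) * x) -` D) = ennreal w * emeasure lborel D"
    if "0 < w" "D \<in> sets borel" for w :: real and D
    using that
    by (subst emeasure_lborel_vimage_affine[of D "1 / w" 0])
      (simp_all add: mult.assoc[symmetric] ennreal_mult[symmetric])
  have ms: "(\<lambda>x. 0 + (1 / w) * x) -` D \<in> sets borel" if "D \<in> sets borel" for w :: real and D
    using measurable_sets_borel[of "\<lambda>x. 0 + (1 / w) * x" borel D] that by simp
  have nonempty: "(\<lambda>x. 0 + (1 / w) * x) -` D \<noteq> {}" if "d \<in> D" "0 < w" for w d :: real and D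
  proof -
    have "w * d \<in> (\<lambda>x. 0 + (1 / w) * x) -` D"
      using that by simp
    then show ?thesis by blast
  qed
  have "emeasure lborel ((\<lambda>x. 0 + (1 / u) * x) -` A) + emeasure lborel ((\<lambda>x. 0 + (1 / v) * x) -` B)
      \<le> emeasure lborel C"
  proof (rule brunn_minkowski_real)
    fix a b assume "a \<in> (\<lambda>x. 0 + (1 / u) * x) -` A" "b \<in> (\<lambda>x. 0 + (1 / v) * x) -` B"
    then show "a + b \<in> C"
      using C[of "a / u" "b / v"] uv by simp
  qed (use assms(1-3) in \<open>simp only: ms\<close>,
      use assms(1-3) in \<open>simp only: ms\<close>, use ne uv nonempty in auto)
  then show ?thesis
    by (simp only: scale uv assms)
qed

text \<open>Tonelli for the region under the graph. The indicator removes negative levels, whose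
  superlevel sets are the whole line.\<close>

lemma nn_integral_layer_cake:
  fixes f :: "real \<Rightarrow> real"
  assumes [measurable]: "f \<in> borel_measurable borel" and nn: "\<And>x. 0 \<le> f x"
  shows "(\<integral>\<^sup>+x. f x \<partial>lborel) = (\<integral>\<^sup>+t. indicator {0..} t * emeasure lborel {x. t < f x} \<partial>lborel)"
proof -
  have "(\<integral>\<^sup>+x. f x \<partial>lborel) = (\<integral>\<^sup>+x. \<integral>\<^sup>+t. indicator {p. 0 \<le> snd p \<and> snd p < f (fst p)} (x, t) \<partial>lborel \<partial>lborel)"
  proof (intro nn_integral_cong)
    fix x
    have "(\<integral>\<^sup>+t. indicator {p. 0 \<le> snd p \<and> snd p < f (fst p)} (x, t) \<partial>lborel)
        = (\<integral>\<^sup>+t. indicator {0..<f x} t \<partial>lborel)"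
      by (intro nn_integral_cong) (auto simp: indicator_def)
    then show "ennreal (f x) = (\<integral>\<^sup>+t. indicator {p. 0 \<le> snd p \<and> snd p < f (fst p)} (x, t) \<partial>lborel)"
      using nn[of x] by simp
  qed
  also have "\<dots> = (\<integral>\<^sup>+t. \<integral>\<^sup>+x. indicator {p. 0 \<le> snd p \<and> snd p < f (fst p)} (x, t) \<partial>lborel \<partial>lborel)"
    by (rule lborel_pair.Fubini') measurable
  also have "\<dots> = (\<integral>\<^sup>+t. indicator {0..} t * emeasure lborel {x. t < f x} \<partial>lborel)"
  proof (intro nn_integral_cong)
    fix t
    have "(\<integral>\<^sup>+x. indicator {p. 0 \<le> snd p \<and> snd p < f (fst p)} (x, t) \<partial>lborel)
        = (\<integral>\<^sup>+x. indicator {0..} t * indicator {x. t < f x} x \<partial>lborel)"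
      by (intro nn_integral_cong) (auto simp: indicator_def)
    also have "\<dots> = indicator {0..} t * emeasure lborel {x. t < f x}"
      by (subst nn_integral_cmult) auto
    finally show "(\<integral>\<^sup>+x. indicator {p. 0 \<le> snd p \<and> snd p < f (fst p)} (x, t) \<partial>lborel)
        = indicator {0..} t * emeasure lborel {x. t < f x}" .
  qed
  finally show ?thesis .
qed

text \<open>The hypothesis \<open>le\<close> puts the combination of the superlevel sets of
  \<open>f\<close> and \<open>g\<close> at level \<open>t\<close> inside that of \<open>h\<close>,
  so Brunn--Minkowski applies level by level. Both suprema being 1 makes the two sets nonempty for
  \<open>t < 1\<close> and empty for \<open>t \<ge> 1\<close>. The result is an arithmetic mean,
  stronger than the geometric one.\<close>

lemma prekopa_leindler_sup_normalized:
  fixes f g h :: "real \<Rightarrow> real"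
  assumes int: "integrable lborel f" "integrable lborel g" "integrable lborel h"
    and nn: "\<And>x. 0 \<le> f x" "\<And>x. 0 \<le> g x" "\<And>x. 0 \<le> h x"
    and sup: "\<And>x. f x \<le> 1" "\<And>x. g x \<le> 1"
      "\<And>t. t < 1 \<Longrightarrow> \<exists>x. t < f x" "\<And>t. t < 1 \<Longrightarrow> \<exists>x. t < g x"
    and uv: "0 < u" "0 < v" "u + v = 1"
    and le: "\<And>x y. f x powr u * g y powr v \<le> h (u * x + v * y)"
  shows "u * (\<integral>x. f x \<partial>lborel) + v * (\<integral>x. g x \<partial>lborel) \<le> (\<integral>x. h x \<partial>lborel)"
proof -
  have [measurable]: "f \<in> borel_measurable borel" "g \<in> borel_measurable borel" "h \<in> borel_measurable borel"
    using int[THEN borel_measurable_integrable] by simp_all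
  have "ennreal u * (\<integral>\<^sup>+x. f x \<partial>lborel) + ennreal v * (\<integral>\<^sup>+x. g x \<partial>lborel)
    = (\<integral>\<^sup>+t. ennreal u * (indicator {0..} t * emeasure lborel {x. t < f x})
         + ennreal v * (indicator {0..} t * emeasure lborel {x. t < g x}) \<partial>lborel)"
    using nn by (simp add: nn_integral_layer_cake nn_integral_add nn_integral_cmult)
  also have "\<dots> \<le> (\<integral>\<^sup>+t. indicator {0..} t * emeasure lborel {x. t < h x} \<partial>lborel)"
  proof (intro nn_integral_mono)
    fix t :: real
    consider "t < 0" | "0 \<le> t" "t < 1" | "1 \<le> t" by linarith
    then show "ennreal u * (indicator {0..} t * emeasure lborel {x. t < f x})
         + ennreal v * (indicator {0..} t * emeasure lborel {x. t < g x})
         \<le> indicator {0..} t * emeasure lborel {x. t < h x}"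
    proof cases
      case 3
      then have "{x. t < f x} = {}" "{x. t < g x} = {}"
        using sup(1,2) by (auto simp: not_less intro: order_trans)
      then show ?thesis by simp
    next
      case 2
      have "ennreal u * emeasure lborel {x. t < f x} + ennreal v * emeasure lborel {x. t < g x}
        \<le> emeasure lborel {x. t < h x}"
      proof (rule brunn_minkowski_real_convex)
        fix a b assume "a \<in> {x. t < f x}" "b \<in> {x. t < g x}"
        then have "t powr u * t powr v < f a powr u * g b powr v"
          using 2 uv by (intro mult_strict_mono' powr_less_mono2) auto
        also have "t powr u * t powr v = t"
          using uv 2 by (simp flip: powr_add)
        finally show "u * a + v * b \<in> {x. t < h x}"
          using le[of a b] by simp
      qed (use sup(3,4)[OF \<open>t < 1\<close>] uv in auto)
      then show ?thesis using 2 by simp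
    qed simp
  qed
  also have "\<dots> = (\<integral>\<^sup>+x. h x \<partial>lborel)"
    using nn by (simp add: nn_integral_layer_cake)
  finally have "ennreal u * ennreal (\<integral>x. f x \<partial>lborel) + ennreal v * ennreal (\<integral>x. g x \<partial>lborel)
      \<le> ennreal (\<integral>x. h x \<partial>lborel)"
    using int nn by (simp add: nn_integral_eq_integral)
  then show ?thesis
    using uv nn by (simp flip: ennreal_mult ennreal_plus)
qed

text \<open>Dividing by the suprema \<open>F\<close> and \<open>G\<close>, and \<open>h\<close> by
  \<open>F powr u * G powr v\<close>, preserves the hypothesis and reaches the normalized case.
  Weighted AM--GM then passes to the geometric mean, in which the scaling factors cancel.\<close>

lemma prekopa_leindler_real:
  fixes f g h :: "real \<Rightarrow> real"
  assumes int: "integrable lborel f" "integrable lborel g" "integrable lborel h"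
    and nn: "\<And>x. 0 \<le> f x" "\<And>x. 0 \<le> g x" "\<And>x. 0 \<le> h x"
    and bd: "bdd_above (range f)" "bdd_above (range g)"
    and uv: "0 < u" "0 < v" "u + v = 1"
    and le: "\<And>x y. f x powr u * g y powr v \<le> h (u * x + v * y)"
  shows "(\<integral>x. f x \<partial>lborel) powr u * (\<integral>x. g x \<partial>lborel) powr v \<le> (\<integral>x. h x \<partial>lborel)"
proof (cases "(\<integral>x. f x \<partial>lborel) = 0 \<or> (\<integral>x. g x \<partial>lborel) = 0")
  case True
  then show ?thesis
    using uv nn by auto
next
  case False
  define F where "F = Sup (range f)"
  define G where "G = Sup (range g)"
  have fF: "f x \<le> F" "g x \<le> G" for x
    unfolding F_def G_def using bd by (auto intro: cSUP_upper)
  have F: "0 < F"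
  proof (rule ccontr)
    assume "\<not> 0 < F"
    then have "f = (\<lambda>_. 0)"
      using nn(1) fF(1) by (intro ext antisym) (auto simp: not_less intro: order_trans)
    with False show False by simp
  qed
  have G: "0 < G"
  proof (rule ccontr)
    assume "\<not> 0 < G"
    then have "g = (\<lambda>_. 0)"
      using nn(2) fF(2) by (intro ext antisym) (auto simp: not_less intro: order_trans)
    with False show False by simp
  qed
  define H where "H = F powr u * G powr v"
  have H: "0 < H" using F G by (simp add: H_def)
  define a where "a = (\<integral>x. f x \<partial>lborel) / F"
  define b where "b = (\<integral>x. g x \<partial>lborel) / G"
  have ab: "0 < a" "0 < b"
    using False F G nn by (auto simp: a_def b_def less_le)
  have "u * (\<integral>x. f x / F \<partial>lborel) + v * (\<integral>x. g x / G \<partial>lborel) \<le> (\<integral>x. h x / H \<partial>lborel)"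
  proof (rule prekopa_leindler_sup_normalized)
    fix t :: real assume "t < 1"
    then have "t * F < F" "t * G < G"
      using F G by auto
    then obtain x y where "t * F < f x" "t * G < g y"
      unfolding F_def G_def less_cSUP_iff[OF UNIV_not_empty bd(1)] less_cSUP_iff[OF UNIV_not_empty bd(2)]
      by auto
    then show "\<exists>x. t < f x / F" "\<exists>x. t < g x / G"
      using F G by (auto simp: field_simps)
  next
    fix x y
    have "(f x / F) powr u * (g y / G) powr v = (f x powr u * g y powr v) / H"
      using F G nn by (simp add: powr_divide H_def)
    then show "(f x / F) powr u * (g y / G) powr v \<le> h (u * x + v * y) / H"
      using le[of x y] H by (simp add: divide_right_mono)
  qed (use F G H nn fF int uv in auto)
  then have "u * a + v * b \<le> (\<integral>x. h x \<partial>lborel) / H"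
    by (simp add: a_def b_def)
  moreover have "a powr u * b powr v \<le> u * a + v * b"
    using uv ab by (intro Youngs_inequality_0) auto
  ultimately have "a powr u * b powr v \<le> (\<integral>x. h x \<partial>lborel) / H"
    by linarith
  then have "a powr u * b powr v * H \<le> (\<integral>x. h x \<partial>lborel)"
    using H by (simp only: pos_le_divide_eq)
  moreover have "a powr u * b powr v * H = (a * F) powr u * (b * G) powr v"
    using ab F G by (simp add: H_def powr_mult)
  ultimately show ?thesis
    using F G by (simp add: a_def b_def)
qed

subsection \<open>Comparison with the Laplace density\<close>

text \<open>The Laplace density with value \<open>c\<close> at 0 is the average of the exponential
  density of rate \<open>2 * c\<close> and its reflection, and for even \<open>k\<close> both have
  the same moment.\<close>

lemma laplace_moment:
  fixes c :: real
  assumes c: "0 < c" and k: "even k"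
  shows "(\<integral>\<^sup>+z. ennreal (c * exp (- 2 * c * \<bar>z\<bar>) * z ^ k) \<partial>lborel) = ennreal (fact k / (2 * c) ^ k)"
proof -
  define d where "d z = ennreal (exponential_density (2 * c) z * z ^ k)" for z
  have [measurable]: "d \<in> borel_measurable borel"
    unfolding d_def by measurable
  have "(\<integral>\<^sup>+z. ennreal (c * exp (- 2 * c * \<bar>z\<bar>) * z ^ k) \<partial>lborel)
      = (\<integral>\<^sup>+z. ennreal (1 / 2) * (d z + d (- z)) \<partial>lborel)"
  proof (intro nn_integral_cong_AE)
    \<comment> \<open>At \<open>z = 0\<close> both one-sided densities are positive, so the identity
      fails there when \<open>k = 0\<close>.\<close>
    show "AE z in lborel. ennreal (c * exp (- 2 * c * \<bar>z\<bar>) * z ^ k) = ennreal (1 / 2) * (d z + d (- z))"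
      using AE_lborel_singleton[of 0]
    proof eventually_elim
      case (elim z)
      then have "d z + d (- z) = ennreal (2 * (c * exp (- 2 * c * \<bar>z\<bar>) * z ^ k))"
        using k by (cases "0 < z") (auto simp: d_def exponential_density_def mult_ac)
      then show ?case
        using c k by (simp only: ennreal_mult'[symmetric]) simp
    qed
  qed
  also have "\<dots> = ennreal (1 / 2) * ((\<integral>\<^sup>+z. d z \<partial>lborel) + (\<integral>\<^sup>+z. d (- z) \<partial>lborel))"
    by (simp add: nn_integral_cmult nn_integral_add)
  also have "(\<integral>\<^sup>+z. d (- z) \<partial>lborel) = (\<integral>\<^sup>+z. d z \<partial>lborel)"
    using nn_integral_real_affine[of d "- 1" 0] by simp
  also have "(\<integral>\<^sup>+z. d z \<partial>lborel) = ennreal (fact k / (2 * c) ^ k)"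
    unfolding d_def using nn_integral_erlang_ith_moment[of "2 * c" 0 k] c by simp
  also have "ennreal (1 / 2) * (ennreal a + ennreal a) = ennreal a" if "0 \<le> a" for a
    using that by (simp only: ennreal_plus[symmetric] ennreal_mult'[symmetric]) simp
  finally show ?thesis
    using c by simp
qed

text \<open>Let \<open>e\<close> be the Laplace density with the same value at 0. If
  \<open>g - e\<close> passes from nonnegative to nonpositive at distance \<open>b\<close>, then
  \<open>(g z - e z) * (z\<^sup>2 - b\<^sup>2)\<close> is never positive. On integration the terms
  with \<open>b\<^sup>2\<close> cancel, since both total masses are 1. The hypothesis
  \<open>star\<close> is log-concavity along rays from 0.\<close>

lemma second_moment_le_laplace:
  fixes g :: "real \<Rightarrow> real"
  assumes [measurable]: "g \<in> borel_measurable borel"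
    and nn: "\<And>z. 0 \<le> g z" and even: "\<And>z. g (- z) = g z"
    and total: "(\<integral>\<^sup>+z. g z \<partial>lborel) = 1" and g0: "0 < g 0"
    and star: "\<And>s z. 0 < s \<Longrightarrow> s < 1 \<Longrightarrow> g 0 powr (1 - s) * g z powr s \<le> g (s * z)"
  shows "(\<integral>\<^sup>+z. ennreal (g z * z\<^sup>2) \<partial>lborel) \<le> ennreal (1 / (2 * (g 0)\<^sup>2))"
proof -
  define c where "c = g 0"
  define e where "e z = c * exp (- 2 * c * \<bar>z\<bar>)" for z
  have c: "0 < c" using g0 by (simp add: c_def)
  have e_pos: "0 < e z" for z using c by (simp add: e_def)
  have [measurable]: "e \<in> borel_measurable borel"
    unfolding e_def by measurable
  have e_total: "(\<integral>\<^sup>+z. e z \<partial>lborel) = 1"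
    unfolding e_def using laplace_moment[OF c, of 0] by simp
  have e_mom: "(\<integral>\<^sup>+z. ennreal (e z * z\<^sup>2) \<partial>lborel) = ennreal (1 / (2 * c\<^sup>2))"
    unfolding e_def using laplace_moment[OF c, of 2] c by (simp add: power2_eq_square)
  have g_abs: "g \<bar>z\<bar> = g z" for z
    using even by (simp add: abs_if)
  have e_abs: "e \<bar>z\<bar> = e z" for z
    by (simp add: e_def)
  \<comment> \<open>\<open>ln e\<close> is affine on the half-line and \<open>ln g\<close> is concave along it from the same starting value,
    so \<open>g\<close> crosses \<open>e\<close> at most once.\<close>
  have initial: "e z \<le> g z" if "0 < z" "z < w" "e w \<le> g w" for z w
  proof -
    define s where "s = z / w"
    have s: "0 < s" "s < 1" "z = s * w" using that by (auto simp: s_def)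
    have "e z = c powr (1 - s) * e w powr s"
    proof -
      have "c = c powr (1 - s) * c powr s"
        using c by (simp flip: powr_add)
      then show ?thesis
        using c that s by (simp add: e_def powr_mult exp_powr_real abs_mult mult_ac)
    qed
    also have "\<dots> \<le> c powr (1 - s) * g w powr s"
      using that s e_pos[of w] by (intro mult_left_mono powr_mono2) auto
    also have "\<dots> \<le> g z"
      using star[of s w] s by (simp add: c_def)
    finally show ?thesis .
  qed
  show ?thesis
  \<comment> \<open>Without a crossing point, equal total masses force \<open>g = e\<close> almost
    everywhere, and the moments agree.\<close>
  proof (cases "\<forall>z>0. e z \<le> g z")
    case True
    have le: "e z \<le> g z" for z
      using True[rule_format, of "\<bar>z\<bar>"] g_abs[of z] e_abs[of z]
      by (cases "z = 0") (auto simp: e_def c_def)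
    have "(\<integral>\<^sup>+z. ennreal (g z) - ennreal (e z) \<partial>lborel) = (\<integral>\<^sup>+z. g z \<partial>lborel) - (\<integral>\<^sup>+z. e z \<partial>lborel)"
      by (rule nn_integral_diff) (use le e_total in \<open>auto intro: ennreal_leI\<close>)
    then have "(\<integral>\<^sup>+z. ennreal (g z) - ennreal (e z) \<partial>lborel) = 0"
      by (simp add: total e_total)
    then have "AE z in lborel. ennreal (g z) - ennreal (e z) = 0"
      by (subst (asm) nn_integral_0_iff_AE) auto
    then have "AE z in lborel. ennreal (g z * z\<^sup>2) = ennreal (e z * z\<^sup>2)"
    proof eventually_elim
      case (elim z)
      then have "g z \<le> e z"
        using e_pos[of z] nn[of z] by (simp add: ennreal_minus ennreal_eq_0_iff less_imp_le)
      with le[of z] show ?case by simp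
    qed
    then have "(\<integral>\<^sup>+z. ennreal (g z * z\<^sup>2) \<partial>lborel) = (\<integral>\<^sup>+z. ennreal (e z * z\<^sup>2) \<partial>lborel)"
      by (rule nn_integral_cong_AE)
    then show ?thesis by (simp add: e_mom c_def)
  next
    case False
    then obtain w where w: "0 < w" "g w < e w" by (auto simp: not_le)
    \<comment> \<open>Inserting 0 keeps \<open>S\<close> nonempty when \<open>g\<close> lies below
      \<open>e\<close> on the whole open half-line; the crossing point is then
      \<open>b = 0\<close>.\<close>
    define S where "S = insert 0 {z. 0 < z \<and> e z \<le> g z}"
    define b where "b = Sup S"
    have bdd: "bdd_above S"
    proof (rule bdd_aboveI[of _ w])
      fix z assume "z \<in> S"
      then show "z \<le> w"
        using initial[of w z] w by (cases "w < z") (auto simp: S_def)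
    qed
    have b0: "0 \<le> b"
      unfolding b_def by (rule cSup_upper[OF _ bdd]) (simp add: S_def)
    have below: "e z \<le> g z" if z: "\<bar>z\<bar> < b" for z
    proof (cases "z = 0")
      case False
      obtain y where y: "y \<in> S" "\<bar>z\<bar> < y"
        using less_cSup_iff[OF _ bdd, of "\<bar>z\<bar>"] z by (auto simp: b_def S_def)
      then have "e \<bar>z\<bar> \<le> g \<bar>z\<bar>"
        using False by (intro initial[of "\<bar>z\<bar>" y]) (auto simp: S_def)
      then show ?thesis by (simp add: g_abs e_abs)
    qed (simp add: e_def c_def)
    have above: "g z \<le> e z" if z: "b < \<bar>z\<bar>" for z
    proof -
      have "\<bar>z\<bar> \<notin> S"
        using cSup_upper[OF _ bdd, of "\<bar>z\<bar>"] z by (auto simp: b_def)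
      then show ?thesis
        using z b0 by (auto simp: S_def g_abs e_abs)
    qed
    \<comment> \<open>The inequality is arranged without subtraction so that it can be integrated in
      \<open>ennreal\<close>. At distance exactly \<open>b\<close> the order of \<open>g\<close> and
      \<open>e\<close> is unknown, but there the factor \<open>z\<^sup>2 - b\<^sup>2\<close>
      vanishes.\<close>
    have pointwise: "g z * z\<^sup>2 + b\<^sup>2 * e z \<le> e z * z\<^sup>2 + b\<^sup>2 * g z" for z
    proof -
      have "(g z - e z) * (z\<^sup>2 - b\<^sup>2) \<le> 0"
      proof (cases "\<bar>z\<bar> < b")
        case True
        then have "z\<^sup>2 \<le> b\<^sup>2"
          using abs_le_square_iff[of z b] b0 by simp
        with below[OF True] show ?thesis by (simp add: mult_nonneg_nonpos)
      next
        case False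
        then have "b\<^sup>2 \<le> z\<^sup>2"
          using abs_le_square_iff[of b z] b0 by simp
        moreover have "g z \<le> e z \<or> z\<^sup>2 = b\<^sup>2"
        proof (cases "b < \<bar>z\<bar>")
          case False
          with \<open>\<not> \<bar>z\<bar> < b\<close> have "\<bar>z\<bar> = b" by simp
          then show ?thesis by (metis power2_abs)
        qed (simp add: above)
        ultimately show ?thesis by (auto simp: mult_nonpos_nonneg)
      qed
      then show ?thesis by (simp add: algebra_simps)
    qed
    have "(\<integral>\<^sup>+z. ennreal (g z * z\<^sup>2) \<partial>lborel) + ennreal (b\<^sup>2)
        = (\<integral>\<^sup>+z. ennreal (g z * z\<^sup>2) + ennreal (b\<^sup>2) * ennreal (e z) \<partial>lborel)"
      by (simp add: nn_integral_add nn_integral_cmult e_total)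
    also have "\<dots> \<le> (\<integral>\<^sup>+z. ennreal (e z * z\<^sup>2) + ennreal (b\<^sup>2) * ennreal (g z) \<partial>lborel)"
    proof (intro nn_integral_mono)
      fix z
      show "ennreal (g z * z\<^sup>2) + ennreal (b\<^sup>2) * ennreal (e z)
          \<le> ennreal (e z * z\<^sup>2) + ennreal (b\<^sup>2) * ennreal (g z)"
        using pointwise[of z] nn[of z] e_pos[of z]
        by (simp add: less_imp_le ennreal_leI flip: ennreal_mult ennreal_plus)
    qed
    also have "\<dots> = ennreal (1 / (2 * c\<^sup>2)) + ennreal (b\<^sup>2)"
      by (simp add: nn_integral_add nn_integral_cmult total e_mom)
    finally show ?thesis
      by (simp add: c_def ennreal_add_left_cancel_le add.commute[of _ "ennreal (b\<^sup>2)"])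
  qed
qed

subsection \<open>Log-concave densities\<close>

text \<open>The multiplicative form of concavity of \<open>ln f\<close> remains meaningful where
  \<open>f\<close> vanishes, since \<open>0 powr u = 0\<close>.\<close>

locale log_concave_density =
  fixes f :: "real \<Rightarrow> real"
  assumes borel [measurable]: "f \<in> borel_measurable borel"
    and nonneg: "\<And>x. 0 \<le> f x"
    and total: "(\<integral>\<^sup>+x. f x \<partial>lborel) = 1"
    and log_concave: "\<And>x y u v. 0 < u \<Longrightarrow> 0 < v \<Longrightarrow> u + v = 1 \<Longrightarrow>
      f x powr u * f y powr v \<le> f (u * x + v * y)"
begin

section \<open>Nondegeneracy, unimodality and boundedness of the density\<close>

lemma integrable: "integrable lborel f"
  using total by (intro integrableI_nonneg) (auto simp: nonneg)

lemma integral: "(\<integral>x. f x \<partial>lborel) = 1"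
  by (simp add: integral_eq_nn_integral nonneg total)

lemma not_AE_zero: "\<not> (AE x in lborel. f x = 0)"
proof
  assume "AE x in lborel. f x = 0"
  then have "(\<integral>\<^sup>+x. f x \<partial>lborel) = (\<integral>\<^sup>+x. 0 \<partial>(lborel :: real measure))"
    by (intro nn_integral_cong_AE) auto
  with total show False by simp
qed

lemma min_le_between:
  assumes "a \<le> z" "z \<le> b"
  shows "min (f a) (f b) \<le> f z"
proof (cases "z = a \<or> z = b")
  case False
  define m where "m = min (f a) (f b)"
  define s where "s = (b - z) / (b - a)"
  have s: "0 < s" "0 < 1 - s" using False assms by (auto simp: s_def field_simps)
  have m: "0 \<le> m" "m \<le> f a" "m \<le> f b" using nonneg by (auto simp: m_def)
  have "s * (b - a) = b - z" using False assms by (simp add: s_def)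
  then have z: "z = s * a + (1 - s) * b" by (simp add: algebra_simps)
  have "m = m powr s * m powr (1 - s)"
    using m by (simp flip: powr_add)
  also have "\<dots> \<le> f a powr s * f b powr (1 - s)"
    using s m by (intro mult_mono powr_mono2) auto
  also have "\<dots> \<le> f z"
    unfolding z using s by (intro log_concave) auto
  finally show ?thesis by (simp add: m_def)
qed auto

text \<open>Take \<open>a < b\<close> with \<open>f\<close> at least \<open>m > 0\<close> on the
  interval between them. For every \<open>x\<close>, the midpoints of \<open>x\<close> and points of
  this interval fill an interval of length \<open>(b - a) / 2\<close>, on which \<open>f\<close> is
  at least \<open>sqrt (f x * m)\<close>. Total mass 1 bounds \<open>f x\<close> uniformly.\<close>

lemma bdd_above: "bdd_above (range f)"
proof -
  \<comment> \<open>A density positive at no more than one point would vanish almost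
    everywhere.\<close>
  have "\<exists>a b. a < b \<and> 0 < f a \<and> 0 < f b"
  proof (rule ccontr)
    assume no: "\<not> ?thesis"
    have "\<exists>a. \<forall>x. x \<noteq> a \<longrightarrow> f x = 0"
    proof (cases "\<exists>a. 0 < f a")
      case True
      then obtain a where "0 < f a" ..
      with no have "f x = 0" if "x \<noteq> a" for x
        using nonneg[of x] that by (metis less_le linorder_neqE_linordered_idom)
      then show ?thesis by blast
    next
      case False
      then show ?thesis using nonneg by (metis less_le)
    qed
    then obtain a where a: "\<And>x. x \<noteq> a \<Longrightarrow> f x = 0" by blast
    have "AE x in lborel. f x = 0"
      using AE_lborel_singleton[of a] by eventually_elim (rule a)
    with not_AE_zero show False ..
  qed
  then obtain a b where ab: "a < b" "0 < f a" "0 < f b" by blast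
  define m where "m = min (f a) (f b)"
  have m: "0 < m" using ab by (simp add: m_def)
  have bound: "sqrt (f x) \<le> 2 / (sqrt m * (b - a))" for x
  proof -
    define q where "q = f x powr (1 / 2) * m powr (1 / 2)"
    have q0: "0 \<le> q" by (simp add: q_def)
    have "ennreal (q * ((b - a) / 2)) = (\<integral>\<^sup>+y. ennreal q * indicator {(x + a) / 2 .. (x + b) / 2} y \<partial>lborel)"
      using ab q0 by (simp add: nn_integral_cmult ennreal_mult diff_divide_distrib add_divide_distrib)
    also have "\<dots> \<le> (\<integral>\<^sup>+y. f y \<partial>lborel)"
    proof (intro nn_integral_mono)
      fix y
      show "ennreal q * indicator {(x + a) / 2 .. (x + b) / 2} y \<le> ennreal (f y)"
      proof (cases "y \<in> {(x + a) / 2 .. (x + b) / 2}")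
        case True
        \<comment> \<open>\<open>y\<close> is the midpoint of \<open>x\<close> and
          \<open>2 * y - x\<close>, and the latter lies between \<open>a\<close> and
          \<open>b\<close>.\<close>
        then have "m \<le> f (2 * y - x)"
          unfolding m_def by (intro min_le_between) (auto simp: field_simps)
        then have "q \<le> f x powr (1 / 2) * f (2 * y - x) powr (1 / 2)"
          unfolding q_def using m by (intro mult_left_mono powr_mono2) auto
        also have "\<dots> \<le> f y"
          using log_concave[of "1 / 2" "1 / 2" x "2 * y - x"] by (simp add: field_simps)
        finally show ?thesis
          using True by (simp add: ennreal_leI)
      qed simp
    qed
    finally have "q * ((b - a) / 2) \<le> 1"
      by (simp add: total)
    then show ?thesis
      using m ab nonneg[of x] by (simp add: q_def powr_half_sqrt field_simps)
  qed
  show ?thesis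
  proof (rule bdd_aboveI2)
    fix x
    have "f x = (sqrt (f x))\<^sup>2" using nonneg by simp
    also have "\<dots> \<le> (2 / (sqrt m * (b - a)))\<^sup>2"
      using nonneg by (intro power_mono bound) auto
    finally show "f x \<le> (2 / (sqrt m * (b - a)))\<^sup>2" .
  qed
qed

lemma upper_boundE:
  obtains C where "0 < C" "\<And>x. f x \<le> C"
proof -
  obtain C where "\<And>x. f x \<le> C"
    using bdd_above by (auto simp: bdd_above_def)
  then have "0 < max C 1" "\<And>x. f x \<le> max C 1"
    by (auto simp: le_max_iff_disj)
  then show ?thesis by (rule that)
qed

section \<open>Powers of the density and the comparison of orders\<close>

lemma bdd_above_compose_powr:
  assumes "0 \<le> p"
  shows "bdd_above (range (\<lambda>x. f (h x) powr p))"
proof -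
  obtain C where C: "0 < C" "\<And>x. f x \<le> C" using upper_boundE by blast
  show ?thesis
    by (rule bdd_aboveI2[of _ _ "C powr p"]) (use assms C nonneg in \<open>auto intro!: powr_mono2\<close>)
qed

lemma integrable_powr:
  assumes p: "1 \<le> p"
  shows "integrable lborel (\<lambda>x. f x powr p)"
proof -
  obtain C where C: "0 < C" "\<And>x. f x \<le> C" using upper_boundE by blast
  have "f x powr p \<le> C powr (p - 1) * f x" for x
  proof -
    have "f x powr p = f x powr (p - 1 + 1)"
      by simp
    also have "\<dots> = f x powr (p - 1) * f x powr 1"
      by (rule powr_add)
    also have "\<dots> \<le> C powr (p - 1) * f x"
      using p C nonneg[of x] by (auto intro!: mult_right_mono powr_mono2)
    finally show ?thesis .
  qed
  then show ?thesis
    using nonneg by (intro Bochner_Integration.integrable_bound[OF integrable_mult_right[OF integrable, of "C powr (p - 1)"]]) auto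
qed

text \<open>The logarithm of \<open>f (x / p) powr p\<close> is the perspective of
  \<open>ln f\<close>, hence jointly concave in \<open>x\<close> and \<open>p\<close>. The dilation
  costs the factor \<open>p\<close>.\<close>

lemma integral_powr_scaled:
  assumes "1 \<le> p"
  shows "integrable lborel (\<lambda>x. f (x / p) powr p)"
    and "(\<integral>x. f (x / p) powr p \<partial>lborel) = p * (\<integral>x. f x powr p \<partial>lborel)"
proof -
  show "integrable lborel (\<lambda>x. f (x / p) powr p)"
    using assms lborel_integrable_real_affine[OF integrable_powr[OF assms], of "1 / p" 0] by simp
  have "(\<integral>x. f x powr p \<partial>lborel) = 1 / p * (\<integral>x. f (x / p) powr p \<partial>lborel)"
    using assms lborel_integral_real_affine[of "1 / p" "\<lambda>x. f x powr p" 0] by simp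
  then show "(\<integral>x. f (x / p) powr p \<partial>lborel) = p * (\<integral>x. f x powr p \<partial>lborel)"
    using assms by simp
qed

text \<open>The weights solve \<open>u + v * \<alpha> = 2\<close>, so that order 2 is interpolated
  between orders 1 and \<open>\<alpha>\<close>. Order 1 contributes the factor 1, and raising to the
  power \<open>\<alpha> - 1 = 1 / v\<close> finishes. For \<open>\<alpha> = 2\<close> the weight
  \<open>u\<close> would be 0, and the two sides coincide.\<close>

lemma mult_integral_powr_le:
  assumes \<alpha>: "2 \<le> \<alpha>"
  shows "\<alpha> * (\<integral>x. f x powr \<alpha> \<partial>lborel) \<le> (2 * (\<integral>x. f x powr 2 \<partial>lborel)) powr (\<alpha> - 1)"
proof (cases "\<alpha> = 2")
  case True
  then show ?thesis by simp
next
  case False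
  define v where "v = 1 / (\<alpha> - 1)"
  define u where "u = (\<alpha> - 2) / (\<alpha> - 1)"
  have uv: "0 < u" "0 < v" "u + v = 1"
    using \<alpha> False by (auto simp: u_def v_def simp flip: add_divide_distrib)
  have "u + v * \<alpha> = 2 * (\<alpha> - 1) / (\<alpha> - 1)"
    by (simp add: u_def v_def flip: add_divide_distrib)
  also have "\<dots> = 2"
    using \<alpha> by (intro nonzero_mult_div_cancel_right) auto
  \<comment> \<open>Pulling out the outer square leaves \<open>u / 2\<close> and
    \<open>v * \<alpha> / 2\<close> as the weights for log-concavity of \<open>f\<close> at
    \<open>x\<close> and \<open>y / \<alpha>\<close>.\<close>
  finally have half: "u / 2 + v * \<alpha> / 2 = 1"
    by simp
  define I where "I = \<alpha> * (\<integral>x. f x powr \<alpha> \<partial>lborel)"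
  have I: "0 \<le> I" using \<alpha> by (simp add: I_def)
  have "(\<integral>x. f x \<partial>lborel) powr u * (\<integral>x. f (x / \<alpha>) powr \<alpha> \<partial>lborel) powr v
      \<le> (\<integral>x. f (x / 2) powr 2 \<partial>lborel)"
  proof (rule prekopa_leindler_real)
    fix x y
    have "f x powr u * (f (y / \<alpha>) powr \<alpha>) powr v
        = (f x powr (u / 2) * f (y / \<alpha>) powr (v * \<alpha> / 2)) powr 2"
      using nonneg by (simp add: powr_mult powr_powr mult.commute)
    also have "\<dots> \<le> f (u / 2 * x + v * \<alpha> / 2 * (y / \<alpha>)) powr 2"
      using uv half \<alpha> by (intro powr_mono2 log_concave) auto
    also have "u / 2 * x + v * \<alpha> / 2 * (y / \<alpha>) = (u * x + v * y) / 2"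
      using \<alpha> by (simp add: field_simps)
    finally show "f x powr u * (f (y / \<alpha>) powr \<alpha>) powr v \<le> f ((u * x + v * y) / 2) powr 2" .
  qed (use \<alpha> uv nonneg integrable integral_powr_scaled integral_powr_scaled(1)[of 2]
    bdd_above bdd_above_compose_powr[of \<alpha> "\<lambda>x. x / \<alpha>"] in auto)
  then have "I powr v \<le> 2 * (\<integral>x. f x powr 2 \<partial>lborel)"
    using \<alpha> by (simp add: integral integral_powr_scaled I_def)
  then have "(I powr v) powr (\<alpha> - 1) \<le> (2 * (\<integral>x. f x powr 2 \<partial>lborel)) powr (\<alpha> - 1)"
    using \<alpha> by (intro powr_mono2) auto
  then show ?thesis
    using \<alpha> I by (simp add: powr_powr v_def I_def)
qed

section \<open>Autocorrelation: the density of the difference of two independent copies\<close>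

definition autocorr :: "real \<Rightarrow> real" where
  "autocorr z = (\<integral>x. f x * f (x + z) \<partial>lborel)"

lemma autocorr_integrable: "integrable lborel (\<lambda>x. f x * f (x + z))"
proof -
  obtain C where C: "0 < C" "\<And>x. f x \<le> C" using upper_boundE by blast
  have "f x * f (x + z) \<le> C * f x" for x
    using mult_left_mono[OF C(2) nonneg] by (simp only: mult.commute[of C])
  then show ?thesis
    using nonneg C(1)
    by (intro Bochner_Integration.integrable_bound[OF integrable_mult_right[OF integrable, of C]]) auto
qed

lemma autocorr_bdd_above: "bdd_above (range (\<lambda>x. f x * f (x + z)))"
proof -
  obtain C where C: "0 < C" "\<And>x. f x \<le> C" using upper_boundE by blast
  show ?thesis
    by (rule bdd_aboveI2[of _ _ "C * C"]) (use C nonneg less_imp_le[OF C(1)] in \<open>auto intro!: mult_mono\<close>)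
qed

lemma autocorr_measurable [measurable]: "autocorr \<in> borel_measurable borel"
  unfolding autocorr_def by measurable

lemma autocorr_nonneg: "0 \<le> autocorr z"
  unfolding autocorr_def using nonneg by simp

lemma autocorr_minus: "autocorr (- z) = autocorr z"
proof -
  have "autocorr (- z) = (\<integral>x. f (z + x) * f x \<partial>lborel)"
    unfolding autocorr_def by (subst lborel_integral_real_affine[of 1 _ z]) auto
  also have "\<dots> = autocorr z"
    unfolding autocorr_def by (intro Bochner_Integration.integral_cong) (simp_all add: mult.commute add.commute)
  finally show ?thesis .
qed

lemma autocorr_zero: "autocorr 0 = (\<integral>x. f x powr 2 \<partial>lborel)"
  unfolding autocorr_def using nonneg by (intro Bochner_Integration.integral_cong) (auto simp: power2_eq_square)

lemma autocorr_zero_pos: "0 < autocorr 0"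
proof (rule ccontr)
  assume "\<not> 0 < autocorr 0"
  then have "(\<integral>x. f x * f (x + 0) \<partial>lborel) = 0"
    using autocorr_nonneg[of 0] unfolding autocorr_def by linarith
  then have "AE x in lborel. f x * f (x + 0) = 0"
    using integral_nonneg_eq_0_iff_AE[OF autocorr_integrable[of 0]] nonneg by simp
  then have "AE x in lborel. f x = 0"
    by eventually_elim simp
  with not_AE_zero show False ..
qed

text \<open>Prekopa--Leindler in the integration variable shows that a marginal inherits
  log-concavity. The factors are regrouped so that log-concavity of \<open>f\<close> applies once to
  the points \<open>x\<close>, \<open>y\<close> and once to \<open>x\<close>,
  \<open>y + z\<close>.\<close>

lemma autocorr_log_concave:
  assumes s: "0 < s" "s < 1"
  shows "autocorr 0 powr (1 - s) * autocorr z powr s \<le> autocorr (s * z)"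
  unfolding autocorr_def
proof (rule prekopa_leindler_real)
  fix x y
  have "(f x * f (x + 0)) powr (1 - s) * (f y * f (y + z)) powr s
      = (f x powr (1 - s) * f y powr s) * (f x powr (1 - s) * f (y + z) powr s)"
    using nonneg by (simp add: powr_mult)
  also have "\<dots> \<le> f ((1 - s) * x + s * y) * f ((1 - s) * x + s * (y + z))"
    using s nonneg by (intro mult_mono log_concave) auto
  finally show "(f x * f (x + 0)) powr (1 - s) * (f y * f (y + z)) powr s
      \<le> f ((1 - s) * x + s * y) * f ((1 - s) * x + s * y + s * z)"
    by (simp add: algebra_simps)
qed (use s nonneg autocorr_integrable autocorr_integrable[of 0] autocorr_bdd_above
    autocorr_bdd_above[of 0] in auto)

text \<open>Tonelli and the substitution \<open>y = x + z\<close>. Keeping \<open>\<phi>\<close>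
  general serves both the total mass and the second moment, and \<open>ennreal\<close> values allow
  its use before any moment is known to be finite.\<close>

lemma nn_integral_autocorr:
  fixes \<phi> :: "real \<Rightarrow> ennreal"
  assumes [measurable]: "\<phi> \<in> borel_measurable borel"
  shows "(\<integral>\<^sup>+z. autocorr z * \<phi> z \<partial>lborel)
    = (\<integral>\<^sup>+x. f x * (\<integral>\<^sup>+y. f y * \<phi> (y - x) \<partial>lborel) \<partial>lborel)"
proof -
  have eq: "ennreal (autocorr z) = (\<integral>\<^sup>+x. f x * f (x + z) \<partial>lborel)" for z
    unfolding autocorr_def
    by (rule nn_integral_eq_integral[symmetric, OF autocorr_integrable]) (simp add: nonneg)
  have "(\<integral>\<^sup>+z. autocorr z * \<phi> z \<partial>lborel) = (\<integral>\<^sup>+z. \<integral>\<^sup>+x. f x * f (x + z) * \<phi> z \<partial>lborel \<partial>lborel)"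
    by (intro nn_integral_cong) (simp add: eq nn_integral_multc)
  also have "\<dots> = (\<integral>\<^sup>+x. \<integral>\<^sup>+z. f x * f (x + z) * \<phi> z \<partial>lborel \<partial>lborel)"
    by (rule lborel_pair.Fubini') measurable
  also have "\<dots> = (\<integral>\<^sup>+x. f x * (\<integral>\<^sup>+y. f y * \<phi> (y - x) \<partial>lborel) \<partial>lborel)"
  proof (intro nn_integral_cong)
    fix x
    have "(\<integral>\<^sup>+y. f y * \<phi> (y - x) \<partial>lborel) = (\<integral>\<^sup>+z. f (x + z) * \<phi> z \<partial>lborel)"
      by (subst nn_integral_real_affine[of _ 1 x]) auto
    then show "(\<integral>\<^sup>+z. f x * f (x + z) * \<phi> z \<partial>lborel) = f x * (\<integral>\<^sup>+y. f y * \<phi> (y - x) \<partial>lborel)"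
      using nonneg by (simp add: ennreal_mult mult.assoc nn_integral_cmult)
  qed
  finally show ?thesis .
qed

lemma nn_integral_square_diff_le:
  "(\<integral>\<^sup>+x. f x * (\<integral>\<^sup>+y. ennreal (f y * (y - x)\<^sup>2) \<partial>lborel) \<partial>lborel) \<le> ennreal (1 / (2 * (autocorr 0)\<^sup>2))"
proof -
  have "(\<integral>\<^sup>+z. autocorr z \<partial>lborel) = 1"
    using nn_integral_autocorr[of "\<lambda>_. 1"] total by simp
  then have "(\<integral>\<^sup>+z. ennreal (autocorr z * z\<^sup>2) \<partial>lborel) \<le> ennreal (1 / (2 * (autocorr 0)\<^sup>2))"
    by (intro second_moment_le_laplace)
      (auto simp: autocorr_nonneg autocorr_minus autocorr_zero_pos autocorr_log_concave)
  then show ?thesis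
    using nn_integral_autocorr[of "\<lambda>z. ennreal (z\<^sup>2)"]
    by (simp add: ennreal_mult[OF nonneg zero_le_power2] ennreal_mult[OF autocorr_nonneg zero_le_power2])
qed

section \<open>Moments and variance\<close>

text \<open>The double integral bounded in \<open>nn_integral_square_diff_le\<close> is finite, so
  the second moment about some point \<open>x\<close> is finite; it remains to move the centre from
  \<open>x\<close> to 0.\<close>

lemma integrable_second_moment: "integrable lborel (\<lambda>y. f y * y\<^sup>2)"
proof -
  let ?J = "\<lambda>x. \<integral>\<^sup>+y. ennreal (f y * (y - x)\<^sup>2) \<partial>lborel"
  have "AE x in lborel. ennreal (f x) * ?J x \<noteq> \<infinity>"
    using nn_integral_square_diff_le by (intro nn_integral_PInf_AE) (auto simp: top_unique)
  have "\<exists>x. 0 < f x \<and> ?J x < \<infinity>"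
  proof (rule ccontr)
    assume no: "\<not> ?thesis"
    have "AE x in lborel. f x = 0"
      using \<open>AE x in lborel. ennreal (f x) * ?J x \<noteq> \<infinity>\<close>
    proof eventually_elim
      case (elim x)
      show ?case
      proof (rule ccontr)
        assume "f x \<noteq> 0"
        then have "0 < f x" using nonneg[of x] by simp
        with no have "\<not> ?J x < \<infinity>" by blast
        then have "?J x = \<infinity>" by (simp add: less_top[symmetric])
        with elim \<open>0 < f x\<close> show False by (simp add: ennreal_mult_eq_top_iff)
      qed
    qed
    with not_AE_zero show False ..
  qed
  then obtain x where "?J x < \<infinity>" by blast
  then have x: "integrable lborel (\<lambda>y. f y * (y - x)\<^sup>2)"
    using nonneg by (intro integrableI_nonneg) auto
  have "f y * y\<^sup>2 \<le> 2 * (f y * (y - x)\<^sup>2) + 2 * x\<^sup>2 * f y" for y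
  proof -
    \<comment> \<open>This square is the difference of the two sides of the next inequality.\<close>
    have "0 \<le> (y - 2 * x)\<^sup>2" by simp
    then have "y\<^sup>2 \<le> 2 * (y - x)\<^sup>2 + 2 * x\<^sup>2"
      by (simp add: power2_eq_square algebra_simps)
    from mult_left_mono[OF this nonneg[of y]] show ?thesis
      by (simp add: algebra_simps)
  qed
  then have le: "norm (f y * y\<^sup>2) \<le> norm (2 * (f y * (y - x)\<^sup>2) + 2 * x\<^sup>2 * f y)" for y
    using nonneg[of y] by (simp only: real_norm_def) (rule order_trans[OF _ abs_ge_self], simp)
  have "integrable lborel (\<lambda>y. 2 * (f y * (y - x)\<^sup>2) + 2 * x\<^sup>2 * f y)"
    using x integrable by simp
  then show ?thesis
    by (rule Bochner_Integration.integrable_bound) (use le in auto)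
qed

lemma integrable_first_moment: "integrable lborel (\<lambda>y. f y * y)"
proof -
  have "\<bar>f y * y\<bar> \<le> f y + f y * y\<^sup>2" for y
  proof -
    have "\<bar>y\<bar> \<le> 1 + y\<^sup>2"
      using zero_le_power2[of "\<bar>y\<bar> - 1"] by (simp add: power2_eq_square algebra_simps)
    from mult_left_mono[OF this nonneg[of y]] show ?thesis
      using nonneg[of y] by (simp add: abs_mult algebra_simps)
  qed
  then have le: "norm (f y * y) \<le> norm (f y + f y * y\<^sup>2)" for y
    by (simp only: real_norm_def) (rule order_trans[OF _ abs_ge_self])
  show ?thesis
    by (rule Bochner_Integration.integrable_bound[OF
          Bochner_Integration.integrable_add[OF integrable integrable_second_moment]])
      (use le in auto)
qed

text \<open>The second moment about \<open>x\<close> is \<open>V + (x - m)\<^sup>2\<close>;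
  averaging over \<open>x\<close> gives \<open>2 * V\<close>, which
  \<open>nn_integral_square_diff_le\<close> bounds. Positivity, needed for the logarithm, holds
  because a density has no mass concentrated at \<open>m\<close>.\<close>

lemma variance_bounds:
  defines "m \<equiv> \<integral>x. f x * x \<partial>lborel"
  defines "V \<equiv> \<integral>x. f x * (x - m)\<^sup>2 \<partial>lborel"
  shows "0 < V" and "V \<le> 1 / (2 * (\<integral>x. f x powr 2 \<partial>lborel))\<^sup>2"
proof -
  have sq: "f y * (y - x)\<^sup>2 = f y * y\<^sup>2 + (- 2 * x) * (f y * y) + x\<^sup>2 * f y" for x y
    by (simp add: power2_eq_square algebra_simps)
  have int: "integrable lborel (\<lambda>y. f y * (y - x)\<^sup>2)" for x
    unfolding sq using integrable integrable_first_moment integrable_second_moment by simp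
  have val: "(\<integral>y. f y * (y - x)\<^sup>2 \<partial>lborel) = (\<integral>y. f y * y\<^sup>2 \<partial>lborel) - 2 * x * m + x\<^sup>2" for x
    unfolding sq using integrable integrable_first_moment integrable_second_moment
    by (simp add: m_def integral)
  have shift: "(\<integral>y. f y * (y - x)\<^sup>2 \<partial>lborel) = V + (x - m)\<^sup>2" for x
    unfolding V_def val by (simp add: power2_eq_square algebra_simps)
  show V: "0 < V"
  proof (rule ccontr)
    assume "\<not> 0 < V"
    moreover have "0 \<le> V" unfolding V_def using nonneg by simp
    ultimately have "V = 0" by linarith
    then have "AE x in lborel. f x * (x - m)\<^sup>2 = 0"
      unfolding V_def by (subst (asm) integral_nonneg_eq_0_iff_AE[OF int[of m]]) (auto simp: nonneg)
    then have "AE x in lborel. f x = 0"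
      using AE_lborel_singleton[of m] by eventually_elim simp
    with not_AE_zero show False ..
  qed
  have "(\<integral>\<^sup>+x. f x * (\<integral>\<^sup>+y. ennreal (f y * (y - x)\<^sup>2) \<partial>lborel) \<partial>lborel)
      = (\<integral>\<^sup>+x. ennreal (V * f x + f x * (x - m)\<^sup>2) \<partial>lborel)"
  proof (intro nn_integral_cong)
    fix x
    have "(\<integral>\<^sup>+y. ennreal (f y * (y - x)\<^sup>2) \<partial>lborel) = ennreal (V + (x - m)\<^sup>2)"
      unfolding shift[symmetric] by (rule nn_integral_eq_integral[OF int]) (simp add: nonneg)
    then show "f x * (\<integral>\<^sup>+y. ennreal (f y * (y - x)\<^sup>2) \<partial>lborel) = ennreal (V * f x + f x * (x - m)\<^sup>2)"
      using V by (simp add: nonneg distrib_left mult.commute[of V] flip: ennreal_mult'[OF nonneg])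
  qed
  also have "\<dots> = ennreal (\<integral>x. V * f x + f x * (x - m)\<^sup>2 \<partial>lborel)"
    using integrable int nonneg V by (intro nn_integral_eq_integral) auto
  also have "(\<integral>x. V * f x + f x * (x - m)\<^sup>2 \<partial>lborel) = 2 * V"
    using integrable int[of m] by (simp add: integral V_def)
  finally have "ennreal (2 * V) \<le> ennreal (1 / (2 * (autocorr 0)\<^sup>2))"
    using nn_integral_square_diff_le by simp
  then have "2 * V \<le> 1 / (2 * (autocorr 0)\<^sup>2)"
    by (subst (asm) ennreal_le_iff) auto
  then show "V \<le> 1 / (2 * (\<integral>x. f x powr 2 \<partial>lborel))\<^sup>2"
    by (simp add: autocorr_zero power2_eq_square field_simps)
qed

text \<open>The variance bound and the comparison of orders meet in \<open>ln (2 * G)\<close>: half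
  of \<open>ln V\<close> is at most its negative, while
  \<open>(ln \<alpha> + ln I) / (\<alpha> - 1)\<close> is at most its value. Adding the two
  eliminates \<open>G\<close>.\<close>

lemma ln_variance_le_entropy:
  defines "m \<equiv> \<integral>x. f x * x \<partial>lborel"
  defines "V \<equiv> \<integral>x. f x * (x - m)\<^sup>2 \<partial>lborel"
  assumes \<alpha>: "2 \<le> \<alpha>"
  shows "1 / 2 * ln V + ln \<alpha> / (\<alpha> - 1) \<le> 1 / (1 - \<alpha>) * ln (\<integral>x. f x powr \<alpha> \<partial>lborel)"
proof -
  define G where "G = (\<integral>x. f x powr 2 \<partial>lborel)"
  define I where "I = (\<integral>x. f x powr \<alpha> \<partial>lborel)"
  have G: "0 < G" using autocorr_zero_pos by (simp add: autocorr_zero G_def)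
  have V: "0 < V" "V \<le> 1 / (2 * G)\<^sup>2"
    unfolding V_def m_def G_def by (rule variance_bounds)+
  have "I \<noteq> 0"
  proof
    assume "I = 0"
    then have "AE x in lborel. f x powr \<alpha> = 0"
      using integral_nonneg_eq_0_iff_AE[OF integrable_powr[of \<alpha>]] \<alpha> by (simp add: I_def)
    then have "AE x in lborel. f x = 0" by eventually_elim simp
    with not_AE_zero show False ..
  qed
  then have I: "0 < I" by (simp add: I_def less_le)
  have "ln V \<le> ln (1 / (2 * G)\<^sup>2)"
    using V by (intro ln_mono) auto
  also have "\<dots> = - 2 * ln (2 * G)"
    using G ln_realpow[of "2 * G" 2] by (simp only: ln_div) (simp add: ln_div)
  finally have lnV: "1 / 2 * ln V \<le> - ln (2 * G)" by simp
  have "ln (\<alpha> * I) \<le> ln ((2 * G) powr (\<alpha> - 1))"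
    using mult_integral_powr_le[OF \<alpha>] I \<alpha> by (intro ln_mono) (auto simp: I_def G_def)
  then have "ln \<alpha> + ln I \<le> (\<alpha> - 1) * ln (2 * G)"
    using I G \<alpha> by (simp add: ln_mult ln_powr)
  then have "(ln \<alpha> + ln I) / (\<alpha> - 1) \<le> ln (2 * G)"
    using \<alpha> by (simp add: pos_divide_le_eq mult.commute)
  moreover have "1 / (1 - \<alpha>) * ln I = - (ln I / (\<alpha> - 1))"
    using \<alpha> by (simp add: field_simps)
  ultimately show ?thesis
    using lnV by (simp add: add_divide_distrib I_def)
qed

end

subsection \<open>Entropy and variance\<close>

text \<open>If \<open>V\<close> is infinite at \<open>x\<close> or \<open>y\<close>, the left side
  is 0. Otherwise convexity makes the value at the combination finite, and the inequality is
  exponentiated.\<close>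

lemma ereal_convex_exp_uminus_log_concave:
  assumes V: "ereal_convex V" and uv: "0 < u" "0 < v" "u + v = 1"
  shows "exp_uminus (V x) powr u * exp_uminus (V y) powr v \<le> exp_uminus (V (u * x + v * y))"
proof (cases "V x = \<infinity> \<or> V y = \<infinity>")
  case True
  then show ?thesis by (auto simp: exp_uminus_def)
next
  case False
  have ninf: "V z \<noteq> - \<infinity>" for z using V by (auto simp: ereal_convex_def)
  have le: "V (u * x + v * y) \<le> ereal u * V x + ereal v * V y"
    using V uv by (auto simp: ereal_convex_def)
  obtain a b where ab: "V x = ereal a" "V y = ereal b"
    using False ninf by (metis ereal_cases)
  then obtain c where c: "V (u * x + v * y) = ereal c"
    using le ninf[of "u * x + v * y"] by (cases "V (u * x + v * y)") auto
  have "c \<le> u * a + v * b"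
    using le by (simp add: ab c)
  then show ?thesis
    by (simp add: ab c exp_uminus_def powr_def flip: exp_add)
qed

text \<open>A power of an exponential density is a multiple of the one with rate
  \<open>\<alpha> * l\<close>, so its integral is explicit. The variance is
  \<open>1 / l\<^sup>2\<close>, whence \<open>- ln l\<close> is half its logarithm.\<close>

lemma renyi_entropy_exponential:
  assumes "prob_space M" and l: "0 < l" and D: "distributed M lborel X (exponential_density l)"
    and \<alpha>: "1 < \<alpha>"
  shows "renyi_entropy M \<alpha> X = 1 / 2 * ln (prob_space.variance M X) + ln \<alpha> / (\<alpha> - 1)"
proof -
  interpret prob_space M by fact
  have "(\<integral>x. exponential_density l x powr \<alpha> \<partial>lborel)
      = (\<integral>x. l powr (\<alpha> - 1) / \<alpha> * exponential_density (\<alpha> * l) x \<partial>lborel)"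
  proof (intro Bochner_Integration.integral_cong refl)
    fix x
    have "l powr \<alpha> = l powr (\<alpha> - 1) * l"
      using powr_add[of l "\<alpha> - 1" 1] l by simp
    then show "exponential_density l x powr \<alpha> = l powr (\<alpha> - 1) / \<alpha> * exponential_density (\<alpha> * l) x"
      using l \<alpha> by (simp add: exponential_density_def powr_mult exp_powr_real mult_ac)
  qed
  also have "\<dots> = l powr (\<alpha> - 1) / \<alpha>"
  proof -
    have "(\<integral>\<^sup>+x. exponential_density (\<alpha> * l) x \<partial>lborel) = 1"
      using nn_integral_erlang_ith_moment[of "\<alpha> * l" 0 0] l \<alpha> by simp
    then have "(\<integral>x. exponential_density (\<alpha> * l) x \<partial>lborel) = 1"
      using l \<alpha> by (subst integral_eq_nn_integral) auto
    then show ?thesis by simp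
  qed
  finally have I: "(\<integral>x. exponential_density l x powr \<alpha> \<partial>lborel) = l powr (\<alpha> - 1) / \<alpha>" .
  have "renyi_entropy M \<alpha> X = 1 / (1 - \<alpha>) * ((\<alpha> - 1) * ln l - ln \<alpha>)"
    using renyi_entropy_distributed[OF D, of \<alpha>] l \<alpha> by (simp add: I ln_div ln_powr)
  also have "\<dots> = - ln l + ln \<alpha> / (\<alpha> - 1)"
    using \<alpha> by (simp add: field_simps)
  also have "- ln l = 1 / 2 * ln (variance X)"
    using l by (simp add: exponential_distributed_variance[OF l D] ln_div ln_realpow)
  finally show ?thesis .
qed

theorem corollary2:
  fixes M :: "'a measure" and X :: "'a \<Rightarrow> real" and \<alpha> :: real
  assumes "prob_space M"
    and "log_concave_rv M X"
    and "2 \<le> \<alpha>"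
  shows "renyi_entropy M \<alpha> X \<ge> 1 / 2 * ln (prob_space.variance M X) + ln \<alpha> / (\<alpha> - 1)
    \<and> (\<forall>l>0. distributed M lborel X (exponential_density l) \<longrightarrow>
          renyi_entropy M \<alpha> X = 1 / 2 * ln (prob_space.variance M X) + ln \<alpha> / (\<alpha> - 1))"
proof (intro conjI allI impI)
  interpret prob_space M by fact
  obtain V where V: "ereal_convex V" and D: "distributed M lborel X (\<lambda>x. ennreal (exp_uminus (V x)))"
    using assms(2) by (auto simp: log_concave_rv_def)
  define f where "f x = exp_uminus (V x)" for x
  have nn: "0 \<le> f x" for x by (simp add: f_def exp_uminus_def)
  have D': "distributed M lborel X (\<lambda>x. ennreal (f x))" using D by (simp add: f_def)
  have fm: "f \<in> borel_measurable borel"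
    using borel_measurable_enn2real[OF distributed_borel_measurable[OF D']] nn by simp
  interpret log_concave_density f
  proof
    show "(\<integral>\<^sup>+x. f x \<partial>lborel) = 1"
      using distributed_nn_integral[OF D', of "\<lambda>_. 1"] by (simp add: emeasure_space_1)
    show "f x powr u * f y powr v \<le> f (u * x + v * y)" if "0 < u" "0 < v" "u + v = 1" for x y u v
      unfolding f_def by (rule ereal_convex_exp_uminus_log_concave[OF V that])
  qed (fact fm nn)+
  \<comment> \<open>Mean and variance become integrals against \<open>f\<close>, matching
    \<open>m\<close> and \<open>V\<close> in \<open>ln_variance_le_entropy\<close>.\<close>
  have "expectation X = (\<integral>x. f x * x \<partial>lborel)"
    using distributed_integral[OF D', of "\<lambda>x. x"] nn by simp
  moreover have "variance X = (\<integral>x. f x * (x - expectation X)\<^sup>2 \<partial>lborel)"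
    using distributed_integral[OF D', of "\<lambda>x. (x - expectation X)\<^sup>2"] nn by simp
  ultimately show "1 / 2 * ln (variance X) + ln \<alpha> / (\<alpha> - 1) \<le> renyi_entropy M \<alpha> X"
    using ln_variance_le_entropy[OF assms(3)] renyi_entropy_distributed[OF D' nn, of \<alpha>] by simp
next
  fix l :: real assume "0 < l" "distributed M lborel X (exponential_density l)"
  then show "renyi_entropy M \<alpha> X = 1 / 2 * ln (prob_space.variance M X) + ln \<alpha> / (\<alpha> - 1)"
    using assms by (intro renyi_entropy_exponential) auto
qed

end
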